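(* Let $\{\mathcal{L}_J:V_D\to V_J\}_{\emptyset\neq J\subseteq D}$ be a family of linear operators satisfying the following two properties for every nonempty $J\subseteq D$: (P2)* for every $g\in V_D$, if $\frac{\partial g}{\partial \mathbf{x}_J}=0$, then $\frac{\partial \mathcal{L}_J(g)}{\partial \mathbf{x}_J}=0$; (P3)* for every $g\in V_J$, $\frac{\partial}{\partial \mathbf{x}_J}\left(\mathcal{L}_J(g)-g\right)=0$. Define linear operators $\{\mathcal{H}_J:V_D\to V_J\}_{J\subseteq D}$ recursively by $$\mathcal{H}_\emptyset:=\mathbb{E},\qquad \mathcal{H}_J:=\Big(I-\sum_{J'\subsetneq J}\mathcal{H}_{J'}\Big)\circ\mathcal{L}_J\quad(\emptyset\neq J\subseteq D).$$ Then $\{\mathcal{H}_J\}_{J\subseteq D}$ satisfies: (P1) $\mathcal{H}_\emptyset=\mathbb{E}$, and $\mathbb{E}\circ\mathcal{H}_J=0$ for all $J\neq\emptyset$; (P2) for all $J\subseteq D$ and $g\in V_D$, if $\frac{\partial g}{\partial \mathbf{x}_J}=0$, then $\mathcal{H}_J(g)=0$; (P3) for all $J\subseteq D$ and $g\in V_J$, $\big(\sum_{J'\subseteq J}\mathcal{H}_{J'}\big)(g)=g$; (P4) $\mathcal{H}_J\circ\mathcal{H}_J=\mathcal{H}_J$ for all $J\subseteq D$; (P5) $\mathcal{H}_{J'}\circ\mathcal{H}_J=0$ for all $J,J'\subseteq D$ with $J'\neq J$. If, in addition, $\{\mathcal{L}_J\}_{\emptyset\neq J\subseteq D}$ satisfies,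 for every nonempty $J\subseteq D$, (P6)* when all feature variables $X_1,\dots,X_d$ are independent, $\frac{\partial}{\partial \mathbf{x}_J}\left(\mathcal{L}_J(g)-\mathbb{E}_{\mathbf{X}_{\setminus J}}(g)\right)=0$ for every $g\in V_D$, then $\{\mathcal{H}_J\}_{J\subseteq D}$ satisfies (P1)--(P5) and also (P6) when all feature variables are independent, $\sum_{J'\subseteq J}\mathcal{H}_{J'}=\mathbb{E}_{\mathbf{X}_{\setminus J}}$ for all $J\subseteq D$.
   Context: Setting. Let $d\ge 1$, $D=\{1,\dots,d\}$, and let $\mathbf{X}_D=(X_1,\dots,X_d)$ be a random vector of real feature variables (possibly dependent), each $X_j$ having compactly supported distribution. Let $\mathcal{X}_j\subset\mathbb{R}$ be the nonempty compact set of values that the variable $x_j$ can take, with $X_j\in\mathcal{X}_j$. $V_D$ is the real vector space of bounded measurable functions $g$ on $\prod_{j\in D}\mathcal{X}_j$; for $J\subseteq D$, $V_J\subseteq V_D$ is the subspace of functions depending only on the variables $\mathbf{x}_J=(x_j)_{j\in J}$, and $V_\emptyset=\mathbb{R}$ (constants). Thus $V_{J'}\subseteq V_J$ if $J'\subseteq J$, and any operators $V_D\to V_J$ and $V_D\to V_{J'}$ can be composed (written $\circ$). Put $\setminus J:=D\setminus J$. Operators. $I$ is the identity of $V_D$; $\mathbb{E}:V_D\to\mathbb{R}$, $\mathbb{E}(g)=\mathbb{E}[g(\mathbf{X}_D)]$; $\mathbb{E}_{\mathbf{X}_{\setminus J}}:V_D\to V_J$, $\mathbb{E}_{\mathbf{X}_{\setminus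 J}}(g)(\mathbf{x}_J)=\mathbb{E}[g(\mathbf{x}_J,\mathbf{X}_{\setminus J})]$ (expectation over the marginal law of $\mathbf{X}_{\setminus J}$, with $\mathbf{x}_J$ fixed). Notation $\frac{\partial g}{\partial\mathbf{x}_J}=0$. Let $g|_{\mathbf{x}_J=\mathbf{c}}$ denote substitution of $\mathbf{c}$ for $\mathbf{x}_J$ in $g$, and put ${}_J\Delta_{\mathbf{a}_J}(g)=\sum_{J'\subseteq J}(-1)^{|J'|}g|_{\mathbf{x}_{J'}=\mathbf{a}_{J'}}$ (the composition over $j\in J$ of the operators $g\mapsto g-g|_{x_j=a_j}$). No differentiability is assumed: "$\frac{\partial g}{\partial \mathbf{x}_J}=0$" means by definition that ${}_J\Delta_{\mathbf{a}_J}(g)=0$ identically for every value $\mathbf{a}_J\in\prod_{j\in J}\mathcal{X}_j$. *)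

theory Defs
  imports "HOL-Probability.Probability"
begin

text \<open>
  Points of the feature space are the extensional functions in \<open>Pi\<^sub>E D \<X>\<close>.  A function on
  the feature space is represented by its extension by zero, so that equality of functions on the
  feature space is HOL equality and the vector space operations are pointwise.
\<close>

type_synonym point = "nat \<Rightarrow> real"
type_synonym rfun = "point \<Rightarrow> real"

definition VD :: "nat set \<Rightarrow> (nat \<Rightarrow> real set) \<Rightarrow> rfun set" where
  "VD D \<X> =
     {g \<in> borel_measurable (\<Pi>\<^sub>M j\<in>D. restrict_space borel (\<X> j)).
        bounded (g ` Pi\<^sub>E D \<X>) \<and> (\<forall>x. x \<notin> Pi\<^sub>E D \<X> \<longrightarrow> g x = 0)}"

definition VJ :: "nat set \<Rightarrow> (nat \<Rightarrow> real set) \<Rightarrow> nat set \<Rightarrow> rfun set" where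
  "VJ D \<X> J =
     {g \<in> VD D \<X>. \<forall>x\<in>Pi\<^sub>E D \<X>. \<forall>y\<in>Pi\<^sub>E D \<X>. (\<forall>j\<in>J. x j = y j) \<longrightarrow> g x = g y}"

definition linear_op :: "rfun set \<Rightarrow> rfun set \<Rightarrow> (rfun \<Rightarrow> rfun) \<Rightarrow> bool" where
  "linear_op U W T \<longleftrightarrow>
     (\<forall>g\<in>U. T g \<in> W) \<and>
     (\<forall>a b. \<forall>g\<in>U. \<forall>h\<in>U. T (\<lambda>x. a * g x + b * h x) = (\<lambda>x. a * T g x + b * T h x))"

definition diff_op :: "nat set \<Rightarrow> point \<Rightarrow> rfun \<Rightarrow> rfun" where
  "diff_op J a g = (\<lambda>x. \<Sum>J'\<in>Pow J. (-1) ^ card J' * g (override_on x a J'))"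

text \<open>The (derivative-free) meaning of \<open>\<partial>g/\<partial>x\<^sub>J = 0\<close>.\<close>

definition partial_zero :: "nat set \<Rightarrow> (nat \<Rightarrow> real set) \<Rightarrow> nat set \<Rightarrow> rfun \<Rightarrow> bool" where
  "partial_zero D \<X> J g \<longleftrightarrow> (\<forall>a\<in>Pi\<^sub>E J \<X>. \<forall>x\<in>Pi\<^sub>E D \<X>. diff_op J a g x = 0)"

text \<open>The expectation operator; real numbers are identified with the constant functions on the
  feature space, i.e. with the elements of \<open>VJ D \<X> {}\<close>.\<close>

definition expect_op ::
  "'w measure \<Rightarrow> nat set \<Rightarrow> (nat \<Rightarrow> 'w \<Rightarrow> real) \<Rightarrow> (nat \<Rightarrow> real set) \<Rightarrow> rfun \<Rightarrow> rfun" where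
  "expect_op M D X \<X> g =
     (\<lambda>x. if x \<in> Pi\<^sub>E D \<X> then (\<integral>\<omega>. g (\<lambda>j\<in>D. X j \<omega>) \<partial>M) else 0)"

text \<open>The operator \<open>g \<mapsto> E[g(x\<^sub>J, X\<^sub>-\<^sub>J)]\<close>, where \<open>-J\<close> denotes the complement of \<open>J\<close> in \<open>D\<close>.\<close>

definition marginal_expect_op ::
  "'w measure \<Rightarrow> nat set \<Rightarrow> (nat \<Rightarrow> 'w \<Rightarrow> real) \<Rightarrow> (nat \<Rightarrow> real set) \<Rightarrow> nat set \<Rightarrow> rfun \<Rightarrow> rfun" where
  "marginal_expect_op M D X \<X> J g =
     (\<lambda>x. if x \<in> Pi\<^sub>E D \<X> then (\<integral>\<omega>. g (override_on (\<lambda>j\<in>D. X j \<omega>) x J) \<partial>M) else 0)"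

text \<open>The recursion is only relevant for finite \<open>J\<close>; the value at infinite \<open>J\<close> is a dummy that
  makes the recursion terminate.\<close>

function hop ::
  "'w measure \<Rightarrow> nat set \<Rightarrow> (nat \<Rightarrow> 'w \<Rightarrow> real) \<Rightarrow> (nat \<Rightarrow> real set) \<Rightarrow>
   (nat set \<Rightarrow> rfun \<Rightarrow> rfun) \<Rightarrow> nat set \<Rightarrow> rfun \<Rightarrow> rfun" where
  "hop M D X \<X> \<L> J =
     (if J = {} then expect_op M D X \<X>
      else if infinite J then (\<lambda>g x. 0)
      else (\<lambda>g x. \<L> J g x - (\<Sum>J' | J' \<subset> J. hop M D X \<X> \<L> J' (\<L> J g) x)))"
  by auto
termination
  by (relation "Wellfounded.measure (\<lambda>(M, D, X, \<X>, \<L>, J). card J)") (auto intro: psubset_card_mono)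

declare hop.simps [simp del]

end

theory Submission
  imports Defs
begin

text \<open>
  Expanding \<open>diff_op J a f = 0\<close> writes \<open>f \<in> V\<^sub>J\<close> as a combination of functions depending on
  fewer variables.  By (P3) and (P2) for smaller sets, \<open>R\<^sub>J = I - (\<Sum>K \<subset> J. H\<^sub>K)\<close> kills
  every \<open>V\<^sub>K\<close> with \<open>K \<subset> J\<close>, hence every such \<open>f\<close>.  Since
  \<open>H\<^sub>J = R\<^sub>J \<circ> \<L>\<^sub>J\<close>, the hypothesis (P2)* gives (P2) for \<open>J\<close>, and (P3)* gives
  \<open>R\<^sub>J \<circ> \<L>\<^sub>J = R\<^sub>J\<close> on \<open>V\<^sub>J\<close>, which is (P3) for \<open>J\<close>.  Properties (P4) and (P5)
  follow by a further induction, and (P1) is (P5) with \<open>J' = {}\<close>.  For (P6), (P6)* gives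
  \<open>R\<^sub>J \<circ> \<L>\<^sub>J = R\<^sub>J \<circ> E\<^sub>J\<close> for the marginal expectation \<open>E\<^sub>J\<close>, and the tower property
  \<open>E\<^sub>K \<circ> E\<^sub>J = E\<^sub>K\<close>, valid under independence, shows that \<open>H\<^sub>K g = H\<^sub>K (E\<^sub>J g)\<close> for
  \<open>K \<subset> J\<close>.
\<close>

subsection \<open>Linear operators and iterated differences\<close>

lemma linear_opD:
  assumes "linear_op U W T" "g \<in> U" "h \<in> U"
  shows "T g \<in> W" "T (\<lambda>x. a * g x + b * h x) = (\<lambda>x. a * T g x + b * T h x)"
  using assms unfolding linear_op_def by blast+

lemma linear_op_subset: "linear_op U W T \<Longrightarrow> U' \<subseteq> U \<Longrightarrow> W \<subseteq> W' \<Longrightarrow> linear_op U' W' T"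
  unfolding linear_op_def by blast

lemma linear_op_comp: "linear_op V W S \<Longrightarrow> linear_op U V T \<Longrightarrow> linear_op U W (\<lambda>g. S (T g))"
  unfolding linear_op_def by simp

lemma linear_op_diff:
  assumes "linear_op U W T" "g \<in> U" "h \<in> U"
  shows "T (\<lambda>x. g x - h x) = (\<lambda>x. T g x - T h x)"
  using linear_opD(2)[OF assms, of 1 "-1"] by simp

lemma linear_op_zero:
  assumes "linear_op U W T" "U \<noteq> {}"
  shows "T (\<lambda>x. 0) = (\<lambda>x. 0)"
proof -
  from assms(2) obtain g where "g \<in> U" by auto
  from linear_opD(2)[OF assms(1) this this, of 0 0] show ?thesis by simp
qed

text \<open>Independence is functional here: overriding coordinate \<open>j\<close> does not change
  \<open>f\<close>, so the summands of \<open>S\<close> with and without \<open>j\<close> cancel in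
  pairs.\<close>

lemma diff_op_eq_0_if_independent:
  assumes "finite J" "j \<in> J"
    and inv: "\<And>S. S \<subseteq> J \<Longrightarrow> f (override_on x a (insert j S)) = f (override_on x a (S - {j}))"
  shows "diff_op J a f x = 0"
proof -
  define t where "t S = (-1) ^ card S * f (override_on x a S)" for S
  \<comment> \<open>Toggling \<open>j\<close> is a sign-reversing involution on the summands.\<close>
  define i where "i S = (if j \<in> S then S - {j} else insert j S)" for S
  have "t (i S) = - t S" if "S \<subseteq> J" for S
  proof -
    have fin: "finite S" using that assms(1) finite_subset by blast
    show ?thesis
    proof (cases "j \<in> S")
      case True
      then have "(-1 :: real) ^ card S = - ((-1) ^ card (S - {j}))"
        by (subst card.remove[OF fin True]) (simp only: power_Suc mult_minus1)
      moreover have "f (override_on x a S) = f (override_on x a (S - {j}))"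
        using inv[OF that] True by (simp add: insert_absorb)
      ultimately show ?thesis using True by (simp add: t_def i_def)
    next
      case False
      then show ?thesis using inv[OF that] fin by (simp add: t_def i_def)
    qed
  qed
  then have "(\<Sum>S\<in>Pow J. t (i S)) = (\<Sum>S\<in>Pow J. - t S)"
    by (intro sum.cong) auto
  moreover have "(\<Sum>S\<in>Pow J. t (i S)) = (\<Sum>S\<in>Pow J. t S)"
    by (rule sum.reindex_bij_witness[of _ i i]) (use assms(2) in \<open>auto simp: i_def\<close>)
  ultimately have "(\<Sum>S\<in>Pow J. t S) = 0" by (simp add: sum_negf)
  then show ?thesis by (simp add: diff_op_def t_def)
qed

subsection \<open>Functions on the feature space\<close>

text \<open>Closedness makes the feature space a measurable set, nonemptiness supplies base points
  for substitution, and \<open>AE_X\<close> lets sample points be treated as points of the feature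
  space up to a null set.\<close>

locale feature_space = prob_space M for M :: "'w measure" +
  fixes D :: "nat set" and X :: "nat \<Rightarrow> 'w \<Rightarrow> real" and \<X> :: "nat \<Rightarrow> real set"
  assumes finite_D: "finite D"
    and X_measurable: "\<And>j. j \<in> D \<Longrightarrow> X j \<in> borel_measurable M"
    and closed_\<X>: "\<And>j. j \<in> D \<Longrightarrow> closed (\<X> j)"
    and nonempty_\<X>: "\<And>j. j \<in> D \<Longrightarrow> \<X> j \<noteq> {}"
    and AE_X: "\<And>j. j \<in> D \<Longrightarrow> AE \<omega> in M. X j \<omega> \<in> \<X> j"
begin

abbreviation "P \<equiv> Pi\<^sub>E D \<X>"
abbreviation "B \<equiv> \<Pi>\<^sub>M j\<in>D. (borel :: real measure)"
abbreviation "V \<equiv> VJ D \<X>"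
abbreviation "pz \<equiv> partial_zero D \<X>"
abbreviation "Exp \<equiv> expect_op M D X \<X>"
abbreviation "Marg \<equiv> marginal_expect_op M D X \<X>"

section \<open>Membership in the function spaces and closure under linear combinations\<close>

lemma P_sets: "P \<in> sets B"
  using finite_D closed_\<X> by (intro sets_PiM_I_finite) auto

lemma P_imp_space: "x \<in> P \<Longrightarrow> x \<in> space B"
  by (auto simp: space_PiM)

text \<open>Extension by zero from the measurable set \<open>P\<close> turns measurability for the
  restricted factors into measurability on the full product \<open>B\<close>, where overriding
  coordinates and integration are easier to handle.\<close>

lemma VD_iff:
  "g \<in> VD D \<X> \<longleftrightarrow> g \<in> borel_measurable B \<and> (\<exists>C. \<forall>x. \<bar>g x\<bar> \<le> C) \<and> (\<forall>x. x \<notin> P \<longrightarrow> g x = 0)"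
proof -
  let ?R = "\<Pi>\<^sub>M j\<in>D. restrict_space borel (\<X> j)"
  have spR: "space ?R = P" by (simp add: space_PiM space_restrict_space)
  \<comment> \<open>Inclusion into \<open>B\<close>, and the identity back from the restriction of
    \<open>B\<close> to \<open>P\<close> in \<open>id2\<close>, carry measurability of
    \<open>g\<close> in both directions by composition.\<close>
  have id1: "(\<lambda>x. x) \<in> measurable ?R B"
  proof (rule measurable_PiM_single')
    show "(\<lambda>x. x j) \<in> borel_measurable ?R" if "j \<in> D" for j
      using measurable_component_singleton[OF that, of "\<lambda>j. restrict_space borel (\<X> j)"]
      by (rule measurable_restrict_space2_iff[THEN iffD1, THEN conjunct1])
  qed (auto simp: spR)
  have id2: "(\<lambda>x. x) \<in> measurable (restrict_space B P) ?R"
  proof (rule measurable_PiM_single')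
    show "(\<lambda>x. x j) \<in> measurable (restrict_space B P) (restrict_space borel (\<X> j))" if "j \<in> D" for j
      by (rule measurable_restrict_space2)
         (use that in \<open>auto simp: space_restrict_space intro!: measurable_restrict_space1\<close>)
  qed (auto simp: space_restrict_space space_PiM)
  have meas: "g \<in> borel_measurable ?R \<longleftrightarrow> g \<in> borel_measurable B" if "\<forall>x. x \<notin> P \<longrightarrow> g x = 0"
  proof
    assume "g \<in> borel_measurable ?R"
    then have "g \<in> borel_measurable (restrict_space B P)"
      using measurable_compose[OF id2] by blast
    moreover have "P \<inter> space B \<in> sets B" using P_sets by auto
    ultimately have "(\<lambda>x. indicator P x *\<^sub>R g x) \<in> borel_measurable B"
      by (subst (asm) borel_measurable_restrict_space_iff) auto
    moreover have "(\<lambda>x. indicator P x *\<^sub>R g x) = g" using that by (auto simp: indicator_def fun_eq_iff)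
    ultimately show "g \<in> borel_measurable B" by simp
  next
    assume "g \<in> borel_measurable B"
    then show "g \<in> borel_measurable ?R"
      using measurable_compose[OF id1] by blast
  qed
  have bdd: "bounded (g ` P) \<longleftrightarrow> (\<exists>C. \<forall>x. \<bar>g x\<bar> \<le> C)" if "\<forall>x. x \<notin> P \<longrightarrow> g x = 0"
  proof
    assume "bounded (g ` P)"
    then obtain C where C: "\<And>x. x \<in> P \<Longrightarrow> \<bar>g x\<bar> \<le> C" by (auto simp: bounded_iff)
    \<comment> \<open>\<open>C\<close> speaks of points of \<open>P\<close> only; the maximum also
      covers the value zero outside.\<close>
    have "\<bar>g x\<bar> \<le> max C 0" for x
      using C[of x] that by (cases "x \<in> P") (auto simp: max_def)
    then show "\<exists>C. \<forall>x. \<bar>g x\<bar> \<le> C" by blast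
  qed (auto simp: bounded_iff)
  show ?thesis using meas bdd unfolding VD_def by blast
qed

lemma VD_lincomb:
  assumes "g \<in> VD D \<X>" "h \<in> VD D \<X>"
  shows "(\<lambda>x. a * g x + b * h x) \<in> VD D \<X>"
proof -
  from assms obtain C C' where C: "\<And>x. \<bar>g x\<bar> \<le> C" "\<And>x. \<bar>h x\<bar> \<le> C'" by (auto simp: VD_iff)
  have "\<bar>a * g x + b * h x\<bar> \<le> \<bar>a\<bar> * C + \<bar>b\<bar> * C'" for x
    using mult_left_mono[OF C(1)[of x], of "\<bar>a\<bar>"] mult_left_mono[OF C(2)[of x], of "\<bar>b\<bar>"]
      abs_triangle_ineq[of "a * g x" "b * h x"] by (simp add: abs_mult)
  then show ?thesis using assms by (auto simp: VD_iff)
qed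

lemma V_eqI:
  assumes "f \<in> V J" "x \<in> P" "y \<in> P" "\<And>j. j \<in> J \<Longrightarrow> x j = y j"
  shows "f x = f y"
  using assms unfolding VJ_def by blast

lemma VI:
  assumes "f \<in> VD D \<X>"
    and "\<And>x y. x \<in> P \<Longrightarrow> y \<in> P \<Longrightarrow> \<forall>j\<in>J. x j = y j \<Longrightarrow> f x = f y"
  shows "f \<in> V J"
  using assms unfolding VJ_def by blast

lemma V_subset_VD: "V J \<subseteq> VD D \<X>"
  unfolding VJ_def by blast

lemma V_outside: "f \<in> V J \<Longrightarrow> x \<notin> P \<Longrightarrow> f x = 0"
  unfolding VJ_def VD_def by blast

lemma V_lincomb:
  assumes g: "g \<in> V J" and h: "h \<in> V J"
  shows "(\<lambda>x. a * g x + b * h x) \<in> V J"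
proof (rule VI)
  show "(\<lambda>x. a * g x + b * h x) \<in> VD D \<X>"
    using g h V_subset_VD by (intro VD_lincomb) auto
  show "a * g x + b * h x = a * g y + b * h y" if "x \<in> P" "y \<in> P" "\<forall>j\<in>J. x j = y j" for x y
    using V_eqI[OF g that(1,2)] V_eqI[OF h that(1,2)] that(3) by simp
qed

lemma V_diff: "g \<in> V J \<Longrightarrow> h \<in> V J \<Longrightarrow> (\<lambda>x. g x - h x) \<in> V J"
  using V_lincomb[of g J h 1 "-1"] by simp

lemma V_zero: "(\<lambda>x. 0) \<in> V J"
  by (rule VI) (auto simp: VD_iff)

lemma V_sum: "(\<And>i. i \<in> I \<Longrightarrow> f i \<in> V J) \<Longrightarrow> (\<lambda>x. \<Sum>i\<in>I. f i x) \<in> V J"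
proof (induction I rule: infinite_finite_induct)
  case (insert i I)
  then show ?case using V_lincomb[of "f i" J "\<lambda>x. \<Sum>i\<in>I. f i x" 1 1] by simp
qed (simp_all add: V_zero)

lemma V_mono: "J \<subseteq> K \<Longrightarrow> V J \<subseteq> V K"
  unfolding VJ_def by blast

text \<open>Points of \<open>P\<close> are extensional, so agreement on \<open>D\<close> is
  equality. The closure lemmas for \<open>V J\<close> thereby serve for the whole space too.\<close>

lemma V_D: "V D = VD D \<X>"
proof
  have "f x = f y" if "x \<in> P" "y \<in> P" "\<forall>j\<in>D. x j = y j" for f :: rfun and x y
  proof -
    have "x = y" using that(3) by (intro PiE_ext[OF that(1,2)]) blast
    then show ?thesis by simp
  qed
  then show "VD D \<X> \<subseteq> V D" by (intro subsetI VI)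
qed (rule V_subset_VD)

lemma VD_nonempty: "VD D \<X> \<noteq> {}"
  using V_zero V_subset_VD by blast

section \<open>Linear operators and finite sums\<close>

lemma linear_op_VD_sum:
  assumes "linear_op (VD D \<X>) W T" "\<And>i. i \<in> I \<Longrightarrow> f i \<in> VD D \<X>"
  shows "T (\<lambda>x. \<Sum>i\<in>I. c i * f i x) = (\<lambda>x. \<Sum>i\<in>I. c i * T (f i) x)"
  using assms(2)
proof (induction I rule: infinite_finite_induct)
  case (insert i I)
  \<comment> \<open>The zero summand brings a scalar multiple into the form of
    \<open>VD_lincomb\<close>.\<close>
  have "(\<lambda>x. 0 * f i x + c k * f k x) \<in> VD D \<X>" if "k \<in> I" for k
    using insert.prems that by (intro VD_lincomb) auto
  then have "(\<lambda>x. \<Sum>i\<in>I. c i * f i x) \<in> VD D \<X>"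
    using V_sum[of I "\<lambda>i x. c i * f i x" D] unfolding V_D by simp
  moreover have "f i \<in> VD D \<X>" using insert.prems by simp
  ultimately show ?case
    using linear_opD(2)[OF assms(1), of "f i" "\<lambda>x. \<Sum>i\<in>I. c i * f i x" "c i" 1] insert by simp
qed (simp_all add: linear_op_zero[OF assms(1) VD_nonempty])

lemma linear_op_V_sum:
  assumes "\<And>i. i \<in> I \<Longrightarrow> linear_op U (V J) (T i)"
  shows "linear_op U (V J) (\<lambda>g x. \<Sum>i\<in>I. T i g x)"
  unfolding linear_op_def
proof (intro conjI ballI allI)
  fix g assume "g \<in> U"
  then show "(\<lambda>x. \<Sum>i\<in>I. T i g x) \<in> V J" using linear_opD(1)[OF assms] by (intro V_sum) auto
next
  fix a b g h assume "g \<in> U" "h \<in> U"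
  then have "T i (\<lambda>x. a * g x + b * h x) = (\<lambda>x. a * T i g x + b * T i h x)" if "i \<in> I" for i
    using linear_opD(2)[OF assms[OF that]] by blast
  then show "(\<lambda>x. \<Sum>i\<in>I. T i (\<lambda>x. a * g x + b * h x) x) =
      (\<lambda>x. a * (\<Sum>i\<in>I. T i g x) + b * (\<Sum>i\<in>I. T i h x))"
    by (simp add: sum.distrib sum_distrib_left)
qed

lemma linear_op_V_id_minus:
  assumes "linear_op (V J) (V J) T"
  shows "linear_op (V J) (V J) (\<lambda>g x. g x - T g x)"
  using assms V_diff unfolding linear_op_def by (simp add: algebra_simps)

section \<open>Vanishing derivatives and substitution\<close>

text \<open>Some variable of \<open>J\<close> lies outside \<open>K\<close>; \<open>f\<close>
  ignores it, so the signed sum over subsets of \<open>J\<close> cancels.\<close>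

lemma partial_zero_V:
  assumes "f \<in> V K" "J \<subseteq> D" "\<not> J \<subseteq> K"
  shows "pz J f"
  unfolding partial_zero_def
proof (intro ballI)
  fix a x assume a: "a \<in> Pi\<^sub>E J \<X>" and x: "x \<in> P"
  obtain j where j: "j \<in> J" "j \<notin> K" using assms(3) by blast
  show "diff_op J a f x = 0"
  proof (rule diff_op_eq_0_if_independent)
    show "finite J" using assms(2) finite_D finite_subset by blast
    show "f (override_on x a (insert j S)) = f (override_on x a (S - {j}))" if "S \<subseteq> J" for S
    proof -
      have "override_on x a S' \<in> P" if "S' \<subseteq> J" for S'
        using that assms(2) a x by (auto simp: override_on_def PiE_iff extensional_def)
      then have "override_on x a (insert j S) \<in> P" "override_on x a (S - {j}) \<in> P"
        using that j by (meson insert_subset Diff_subset subset_trans)+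
      then show ?thesis
        by (rule V_eqI[OF assms(1)]) (use j in \<open>auto simp: override_on_def\<close>)
    qed
  qed fact
qed

lemma partial_zero_empty:
  assumes "g \<in> VD D \<X>" "pz {} g"
  shows "g = (\<lambda>x. 0)"
proof
  fix x show "g x = 0"
    using assms by (cases "x \<in> P") (auto simp: partial_zero_def diff_op_def VD_def)
qed

text \<open>Freezing the coordinates in \<open>S\<close> leaves a dependence on \<open>J - S\<close>
  only. The reset to zero is essential: overriding can move a point from outside \<open>P\<close>
  into \<open>P\<close>.\<close>

lemma substitution_in_V:
  assumes "f \<in> V J" "J \<subseteq> D" "S \<subseteq> J" "a \<in> Pi\<^sub>E J \<X>"
  shows "(\<lambda>x. if x \<in> P then f (override_on x a S) else 0) \<in> V (J - S)"
proof -
  have f: "f \<in> VD D \<X>" using assms(1) V_subset_VD by blast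
  then obtain C where C: "\<And>x. \<bar>f x\<bar> \<le> C" unfolding VD_iff by blast
  have "(\<lambda>x. override_on x a S) \<in> measurable B B"
  proof (rule measurable_PiM_single')
    show "(\<lambda>x. override_on x a S j) \<in> borel_measurable B" if "j \<in> D" for j
      using that by (cases "j \<in> S") (simp_all add: override_on_def)
  qed (use assms(2,3) in \<open>auto simp: space_PiM override_on_def PiE_iff extensional_def\<close>)
  moreover have "f \<in> borel_measurable B" using f unfolding VD_iff by blast
  ultimately have meas: "(\<lambda>x. f (override_on x a S)) \<in> borel_measurable B"
    by (rule measurable_compose)
  define u where "u x = (if x \<in> P then f (override_on x a S) else 0)" for x
  have "0 \<le> C" using C[of a] by linarith
  then have "\<bar>u x\<bar> \<le> C" for x
    using C[of "override_on x a S"] by (simp add: u_def)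
  moreover have "u \<in> borel_measurable B"
    unfolding u_def using P_sets meas by (intro measurable_If_set) auto
  moreover have "u x = 0" if "x \<notin> P" for x using that by (simp add: u_def)
  ultimately have VD: "u \<in> VD D \<X>" unfolding VD_iff by blast
  have sub: "override_on z a S \<in> P" if "z \<in> P" for z
    using that assms(2-4) by (auto simp: override_on_def PiE_iff extensional_def)
  have "u \<in> V (J - S)"
  proof (rule VI[OF VD])
    fix x y assume x: "x \<in> P" and y: "y \<in> P" and xy: "\<forall>j\<in>J - S. x j = y j"
    have "f (override_on x a S) = f (override_on y a S)"
      by (rule V_eqI[OF assms(1) sub[OF x] sub[OF y]]) (use xy in \<open>simp add: override_on_def\<close>)
    then show "u x = u y" using x y by (simp only: u_def if_True)
  qed
  then show ?thesis unfolding u_def .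
qed

text \<open>In the expanded difference the empty set contributes \<open>f\<close> itself; solving
  for it leaves substitutions along nonempty \<open>S\<close>, each depending on a proper subset of
  the variables in \<open>J\<close>.\<close>

lemma partial_zero_decomposition:
  assumes f: "f \<in> V J" and J: "J \<subseteq> D" and pz: "pz J f"
  obtains c u where "\<And>S. S \<in> Pow J - {{}} \<Longrightarrow> u S \<in> V (J - S)"
    "f = (\<lambda>x. \<Sum>S\<in>Pow J - {{}}. c S * u S x)"
proof -
  have "Pi\<^sub>E J \<X> \<noteq> {}" using nonempty_\<X> J unfolding PiE_eq_empty_iff by blast
  then obtain a where a: "a \<in> Pi\<^sub>E J \<X>" by blast
  define u where "u S = (\<lambda>x. if x \<in> P then f (override_on x a S) else 0)" for S
  \<comment> \<open>The sign is opposite to that in \<open>diff_op\<close>, because these terms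
    change sides.\<close>
  define c :: "nat set \<Rightarrow> real" where "c S = - ((-1) ^ card S)" for S
  have fin: "finite J" using J finite_D finite_subset by blast
  show ?thesis
  proof
    show "u S \<in> V (J - S)" if "S \<in> Pow J - {{}}" for S
    proof -
      have "S \<subseteq> J" using that by blast
      then show ?thesis unfolding u_def by (rule substitution_in_V[OF f J _ a])
    qed
    show "f = (\<lambda>x. \<Sum>S\<in>Pow J - {{}}. c S * u S x)"
    proof
      fix x
      show "f x = (\<Sum>S\<in>Pow J - {{}}. c S * u S x)"
      proof (cases "x \<in> P")
        case True
        let ?S = "\<Sum>S\<in>Pow J - {{}}. (-1) ^ card S * f (override_on x a S)"
        have "(\<Sum>S\<in>Pow J - {{}}. c S * u S x) = - ?S"
          unfolding sum_negf[symmetric] by (intro sum.cong) (simp_all add: c_def u_def True)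
        moreover have "diff_op J a f x = f x + ?S"
          unfolding diff_op_def using fin sum.remove[of "Pow J" "{}" "\<lambda>S. (-1) ^ card S * f (override_on x a S)"]
          by simp
        moreover have "diff_op J a f x = 0"
          using pz a True unfolding partial_zero_def by blast
        ultimately show ?thesis by linarith
      next
        case False
        then show ?thesis using V_outside[OF f] by (simp add: u_def)
      qed
    qed
  qed
qed

subsection \<open>Marginal expectations\<close>

lemma Marg_empty: "Marg {} = Exp"
  by (auto simp: marginal_expect_op_def expect_op_def fun_eq_iff)

text \<open>Joint measurability in \<open>x\<close> and \<open>\<omega>\<close> is what makes the
  integral over \<open>\<omega>\<close> a measurable function of \<open>x\<close>.\<close>

lemma override_measurable:
  assumes "J \<subseteq> D"
  shows "(\<lambda>(x, \<omega>). override_on (\<lambda>j\<in>D. X j \<omega>) x J) \<in> measurable (B \<Otimes>\<^sub>M M) B"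
proof (rule measurable_PiM_single')
  show "(\<lambda>z. (case z of (x, \<omega>) \<Rightarrow> override_on (\<lambda>j\<in>D. X j \<omega>) x J) j) \<in> borel_measurable (B \<Otimes>\<^sub>M M)"
    if "j \<in> D" for j
    using that X_measurable
    by (cases "j \<in> J") (auto simp: override_on_def case_prod_beta)
qed (use assms in \<open>auto simp: space_pair_measure space_PiM override_on_def PiE_iff extensional_def\<close>)

lemma VD_override_measurable:
  assumes "g \<in> VD D \<X>" "J \<subseteq> D"
  shows "(\<lambda>(x, \<omega>). g (override_on (\<lambda>j\<in>D. X j \<omega>) x J)) \<in> borel_measurable (B \<Otimes>\<^sub>M M)"
  using measurable_compose[OF override_measurable[OF assms(2)], of g borel] assms(1)
  by (simp add: VD_iff case_prod_beta)

lemma VD_override_integrable: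
  assumes "g \<in> VD D \<X>" "J \<subseteq> D" "x \<in> P"
  shows "integrable M (\<lambda>\<omega>. g (override_on (\<lambda>j\<in>D. X j \<omega>) x J))"
proof -
  obtain C where "\<And>x. \<bar>g x\<bar> \<le> C" using assms(1) by (auto simp: VD_iff)
  moreover have "(\<lambda>\<omega>. g (override_on (\<lambda>j\<in>D. X j \<omega>) x J)) \<in> borel_measurable M"
    using measurable_Pair2[OF VD_override_measurable[OF assms(1,2)] P_imp_space[OF assms(3)]] by simp
  ultimately show ?thesis by (intro integrable_const_bound[where B = C]) auto
qed

lemma AE_override_in_P:
  assumes "J \<subseteq> D" "x \<in> P"
  shows "AE \<omega> in M. override_on (\<lambda>j\<in>D. X j \<omega>) x J \<in> P"
proof -
  have "AE \<omega> in M. \<forall>j\<in>D. X j \<omega> \<in> \<X> j" using AE_X finite_D by (simp add: AE_finite_all)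
  then show ?thesis
    by eventually_elim (use assms in \<open>auto simp: override_on_def PiE_iff extensional_def\<close>)
qed

text \<open>Averaging over a probability measure preserves a uniform bound, and the integrand sees
  \<open>x\<close> only through its coordinates in \<open>J\<close>.\<close>

lemma Marg_in_V:
  assumes g: "g \<in> VD D \<X>" and J: "J \<subseteq> D"
  shows "Marg J g \<in> V J"
proof -
  let ?F = "\<lambda>x. \<integral>\<omega>. g (override_on (\<lambda>j\<in>D. X j \<omega>) x J) \<partial>M"
  obtain C where C: "\<And>x. \<bar>g x\<bar> \<le> C" using g by (auto simp: VD_iff)
  have "?F \<in> borel_measurable B"
    using VD_override_measurable[OF g J] by (rule borel_measurable_lebesgue_integral)
  then have meas: "Marg J g \<in> borel_measurable B"
    unfolding marginal_expect_op_def using P_sets by (intro measurable_If_set) auto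
  have "0 \<le> C" using C[of undefined] by linarith
  have "\<bar>?F x\<bar> \<le> C" if "x \<in> P" for x
  proof -
    have int: "integrable M (\<lambda>\<omega>. g (override_on (\<lambda>j\<in>D. X j \<omega>) x J))"
      using VD_override_integrable[OF g J that] .
    have "- C \<le> g y" "g y \<le> C" for y using C[of y] by linarith+
    then have "- C \<le> ?F x" "?F x \<le> C"
      by (auto intro!: integral_le_const integral_ge_const int)
    then show ?thesis by linarith
  qed
  then have bound: "\<bar>Marg J g x\<bar> \<le> C" for x
    using \<open>0 \<le> C\<close> by (simp add: marginal_expect_op_def)
  have "Marg J g x = 0" if "x \<notin> P" for x
    using that by (simp add: marginal_expect_op_def)
  then have VD: "Marg J g \<in> VD D \<X>"
    unfolding VD_iff using meas bound by blast
  show ?thesis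
  proof (rule VI[OF VD])
    fix x y assume "x \<in> P" "y \<in> P" and xy: "\<forall>j\<in>J. x j = y j"
    moreover have "override_on w x J = override_on w y J" for w
      using xy by (auto simp: override_on_def)
    ultimately show "Marg J g x = Marg J g y" by (simp add: marginal_expect_op_def)
  qed
qed

lemma linear_op_Marg:
  assumes "J \<subseteq> D"
  shows "linear_op (VD D \<X>) (V J) (Marg J)"
  using Marg_in_V[OF _ assms] VD_override_integrable[OF _ assms]
  unfolding linear_op_def by (auto simp: marginal_expect_op_def fun_eq_iff)

lemma linear_op_Exp: "linear_op (VD D \<X>) (V {}) Exp"
  using linear_op_Marg[of "{}"] by (simp add: Marg_empty)

text \<open>Such a \<open>g\<close> is constant on \<open>P\<close>, the sample point lies in
  \<open>P\<close> almost surely, and the total mass is one. This is (P3) for the empty set.\<close>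

lemma Exp_V_empty:
  assumes "g \<in> V {}"
  shows "Exp g = g"
proof
  fix x
  show "Exp g x = g x"
  proof (cases "x \<in> P")
    case True
    have "AE \<omega> in M. (\<lambda>j\<in>D. X j \<omega>) \<in> P"
      using AE_override_in_P[OF empty_subsetI True] by (simp only: override_on_emptyset)
    then have "AE \<omega> in M. g (\<lambda>j\<in>D. X j \<omega>) = g x"
      by eventually_elim (rule V_eqI[OF assms _ True], simp_all only: empty_iff)
    moreover have "integrable M (\<lambda>\<omega>. g (\<lambda>j\<in>D. X j \<omega>))"
      using VD_override_integrable[OF subsetD[OF V_subset_VD assms] empty_subsetI True]
      by (simp only: override_on_emptyset)
    ultimately have "(\<integral>\<omega>. g (\<lambda>j\<in>D. X j \<omega>) \<partial>M) = (\<integral>\<omega>. g x \<partial>M)"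
      by (intro integral_cong_AE borel_measurable_integrable) simp_all
    then show ?thesis using True by (simp add: expect_op_def prob_space)
  next
    case False
    then show ?thesis using V_outside[OF assms] by (simp add: expect_op_def)
  qed
qed

section \<open>Iterated marginal expectations under independence\<close>

lemma override_X_measurable:
  assumes "J \<subseteq> D" "x \<in> space B"
  shows "(\<lambda>z. override_on z x J) \<in> measurable B B"
proof (rule measurable_PiM_single')
  show "(\<lambda>z. override_on z x J j) \<in> borel_measurable B" if "j \<in> D" for j
    using that by (cases "j \<in> J") (simp_all add: override_on_def)
qed (use assms in \<open>auto simp: space_PiM override_on_def PiE_iff extensional_def\<close>)

text \<open>Subvectors over \<open>J\<close> and over its complement are independent, so drawing
  them from two separate samples does not change the law of the whole vector; the rest is
  Fubini.\<close>

lemma indep_integral_split: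
  fixes F :: "point \<Rightarrow> real"
  assumes ind: "indep_vars (\<lambda>_. borel) X D" and J: "J \<subseteq> D"
    and F: "F \<in> borel_measurable B" and C: "\<And>z. \<bar>F z\<bar> \<le> C"
  shows "(\<integral>\<omega>. \<integral>\<omega>'. F (override_on (\<lambda>j\<in>D. X j \<omega>') (\<lambda>j\<in>D. X j \<omega>) J) \<partial>M \<partial>M) =
    (\<integral>\<omega>. F (\<lambda>j\<in>D. X j \<omega>) \<partial>M)"
proof -
  \<comment> \<open>\<open>Y K\<close> is the subvector indexed by \<open>K\<close>, with values in
    \<open>N K\<close>, and \<open>\<mu> K\<close> is its law.\<close>
  define N where "N K = (\<Pi>\<^sub>M j\<in>K. (borel :: real measure))" for K :: "nat set"
  define Y where "Y K \<omega> = (\<lambda>j\<in>K. X j \<omega>)" for K \<omega>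
  define \<mu> where "\<mu> K = distr M (N K) (Y K)" for K
  have Y: "Y K \<in> measurable M (N K)" if "K \<subseteq> D" for K
    unfolding Y_def N_def using that X_measurable by (intro measurable_restrict) auto
  let ?K = "D - J"
  let ?G = "\<lambda>z. F (merge J ?K z)"
  have "J \<union> ?K = D" using J by blast
  then have mg: "merge J ?K \<in> measurable (N J \<Otimes>\<^sub>M N ?K) B"
    unfolding N_def using measurable_merge[of J ?K "\<lambda>_. borel"] by simp
  then have G: "?G \<in> borel_measurable (N J \<Otimes>\<^sub>M N ?K)"
    using F by (rule measurable_compose)
  have "indep_var (N J) (Y J) (N ?K) (Y ?K)"
    unfolding N_def Y_def by (rule indep_var_restrict[OF ind]) (use J in auto)
  then have eq: "distr M (N J \<Otimes>\<^sub>M N ?K) (\<lambda>\<omega>. (Y J \<omega>, Y ?K \<omega>)) = \<mu> J \<Otimes>\<^sub>M \<mu> ?K"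
    unfolding \<mu>_def by (simp add: indep_var_distribution_eq)
  interpret \<mu>J: prob_space "\<mu> J" unfolding \<mu>_def using Y J by (intro prob_space_distr) auto
  interpret \<mu>K: prob_space "\<mu> ?K" unfolding \<mu>_def using Y by (intro prob_space_distr) auto
  interpret pair_prob_space "\<mu> J" "\<mu> ?K" ..
  have setsP: "sets (\<mu> J \<Otimes>\<^sub>M \<mu> ?K) = sets (N J \<Otimes>\<^sub>M N ?K)"
    by (intro sets_pair_measure_cong) (simp_all add: \<mu>_def)
  have merge_eq: "merge J ?K (Y J \<omega>, Y ?K \<omega>') = override_on (Y D \<omega>') (Y D \<omega>) J" for \<omega> \<omega>'
    using J by (auto simp: merge_def Y_def override_on_def fun_eq_iff)
  have int: "integrable (\<mu> J \<Otimes>\<^sub>M \<mu> ?K) ?G"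
    using G C by (intro P.integrable_const_bound[where B = C]) (auto simp: measurable_cong_sets[OF setsP refl])
  have G1: "(\<lambda>v. ?G (u, v)) \<in> borel_measurable (N ?K)" if "u \<in> space (N J)" for u
    using measurable_Pair2[OF G that] .
  \<comment> \<open>Merging two subvectors of the same sample restores the full vector.\<close>
  have "(\<integral>\<omega>. F (Y D \<omega>) \<partial>M) = (\<integral>\<omega>. ?G (Y J \<omega>, Y ?K \<omega>) \<partial>M)"
    by (simp add: merge_eq override_on_def)
  also have "\<dots> = (\<integral>z. ?G z \<partial>(\<mu> J \<Otimes>\<^sub>M \<mu> ?K))"
    unfolding eq[symmetric] using Y J G by (subst integral_distr) (auto intro!: measurable_Pair)
  also have "\<dots> = (\<integral>u. \<integral>v. ?G (u, v) \<partial>\<mu> ?K \<partial>\<mu> J)"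
    using integral_fst'[OF int] by simp
  also have "\<dots> = (\<integral>\<omega>. \<integral>v. ?G (Y J \<omega>, v) \<partial>\<mu> ?K \<partial>M)"
    unfolding \<mu>_def[of J]
  proof (rule integral_distr)
    \<comment> \<open>\<open>\<mu> ?K\<close> has the same measurable sets as \<open>N ?K\<close>;
      this form fits the measurability of an integral with respect to \<open>\<mu> ?K\<close> in its
      parameter.\<close>
    have "?G \<in> borel_measurable (N J \<Otimes>\<^sub>M \<mu> ?K)"
      using G by (subst measurable_cong_sets[OF sets_pair_measure_cong[OF refl] refl, of _ "N ?K"])
        (auto simp: \<mu>_def)
    then have "(\<lambda>(u, v). ?G (u, v)) \<in> borel_measurable (N J \<Otimes>\<^sub>M \<mu> ?K)" by simp
    then show "(\<lambda>u. \<integral>v. ?G (u, v) \<partial>\<mu> ?K) \<in> borel_measurable (N J)"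
      by (rule \<mu>K.borel_measurable_lebesgue_integral)
  qed (rule Y[OF J])
  also have "\<dots> = (\<integral>\<omega>. \<integral>\<omega>'. ?G (Y J \<omega>, Y ?K \<omega>') \<partial>M \<partial>M)"
  proof (rule Bochner_Integration.integral_cong[OF refl])
    fix \<omega> assume "\<omega> \<in> space M"
    then have "Y J \<omega> \<in> space (N J)" using Y[OF J] by (rule measurable_space[rotated])
    then show "(\<integral>v. ?G (Y J \<omega>, v) \<partial>\<mu> ?K) = (\<integral>\<omega>'. ?G (Y J \<omega>, Y ?K \<omega>') \<partial>M)"
      unfolding \<mu>_def using Y[of ?K] G1 by (intro integral_distr) auto
  qed
  finally show ?thesis unfolding merge_eq by (simp add: Y_def)
qed

text \<open>After both averages, coordinates in \<open>K\<close> come from \<open>x\<close>, those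
  in \<open>J - K\<close> from one sample and those outside \<open>J\<close> from another.
  Independence lets one sample replace the two.\<close>

lemma Marg_tower:
  assumes ind: "indep_vars (\<lambda>_. borel) X D" and J: "J \<subseteq> D" and K: "K \<subseteq> J"
    and g: "g \<in> VD D \<X>"
  shows "Marg K (Marg J g) = Marg K g"
proof
  fix x
  let ?Y = "\<lambda>\<omega>. \<lambda>j\<in>D. X j \<omega>"
  let ?G = "\<lambda>y. \<integral>\<omega>'. g (override_on (?Y \<omega>') y J) \<partial>M"
  have KD: "K \<subseteq> D" using J K by blast
  obtain C where C: "\<And>x. \<bar>g x\<bar> \<le> C" using g by (auto simp: VD_iff)
  show "Marg K (Marg J g) x = Marg K g x"
  proof (cases "x \<in> P")
    case True
    let ?F = "\<lambda>z. g (override_on z x K)"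
    have om: "(\<lambda>z. override_on z x K) \<in> measurable B B"
      using override_X_measurable[OF KD P_imp_space[OF True]] .
    have Y: "?Y \<in> measurable M B" using X_measurable by (intro measurable_restrict) auto
    have G: "?G \<in> borel_measurable B"
      using VD_override_measurable[OF g J] by (rule borel_measurable_lebesgue_integral)
    have Gm: "(\<lambda>\<omega>. ?G (override_on (?Y \<omega>) x K)) \<in> borel_measurable M"
      using measurable_compose[OF measurable_compose[OF Y om] G] .
    \<comment> \<open>Since \<open>K\<close> is contained in \<open>J\<close>, the values of
      \<open>x\<close> on \<open>K\<close> prevail in either order.\<close>
    have swap: "override_on (?Y \<omega>') (override_on (?Y \<omega>) x K) J =
        override_on (override_on (?Y \<omega>') (?Y \<omega>) J) x K" for \<omega> \<omega>'
      using K by (auto simp: override_on_def fun_eq_iff)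
    have "(\<integral>\<omega>. Marg J g (override_on (?Y \<omega>) x K) \<partial>M) = (\<integral>\<omega>. ?G (override_on (?Y \<omega>) x K) \<partial>M)"
    \<comment> \<open>\<open>Marg J g\<close> equals the plain integral only on \<open>P\<close>,
      which the overridden point hits almost surely.\<close>
    proof (rule integral_cong_AE)
      show "(\<lambda>\<omega>. Marg J g (override_on (?Y \<omega>) x K)) \<in> borel_measurable M"
        using VD_override_integrable[OF _ KD True, of "Marg J g"] Marg_in_V[OF g J] V_subset_VD by blast
      show "AE \<omega> in M. Marg J g (override_on (?Y \<omega>) x K) = ?G (override_on (?Y \<omega>) x K)"
        using AE_override_in_P[OF KD True] by eventually_elim (simp add: marginal_expect_op_def)
    qed (rule Gm)
    also have "\<dots> = (\<integral>\<omega>. ?F (?Y \<omega>) \<partial>M)"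
      unfolding swap
    proof (rule indep_integral_split[OF ind J])
      show "?F \<in> borel_measurable B"
        using measurable_compose[OF om, of g borel] g by (simp add: VD_iff)
    qed (rule C)
    finally show ?thesis using True by (simp add: marginal_expect_op_def)
  qed (simp add: marginal_expect_op_def)
qed

end

subsection \<open>Hierarchical decomposition\<close>

locale hierarchical_decomposition = feature_space M D X \<X>
  for M :: "'w measure" and D X \<X> +
  fixes \<L> :: "nat set \<Rightarrow> rfun \<Rightarrow> rfun"
  assumes L_linear: "\<And>J. J \<noteq> {} \<Longrightarrow> J \<subseteq> D \<Longrightarrow> linear_op (VD D \<X>) (VJ D \<X> J) (\<L> J)"
    and L_partial_zero: "\<And>J g. J \<noteq> {} \<Longrightarrow> J \<subseteq> D \<Longrightarrow> g \<in> VD D \<X> \<Longrightarrow>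
      partial_zero D \<X> J g \<Longrightarrow> partial_zero D \<X> J (\<L> J g)"
    and L_minus_id: "\<And>J g. J \<noteq> {} \<Longrightarrow> J \<subseteq> D \<Longrightarrow> g \<in> VJ D \<X> J \<Longrightarrow>
      partial_zero D \<X> J (\<lambda>x. \<L> J g x - g x)"
begin

abbreviation "H \<equiv> hop M D X \<X> \<L>"

text \<open>The operator \<open>R\<^sub>J\<close> of the overview. It involves \<open>H\<close> at
  proper subsets of \<open>J\<close> only, so its properties can be derived from induction
  hypotheses.\<close>

definition residual :: "nat set \<Rightarrow> rfun \<Rightarrow> rfun" where
  "residual J f = (\<lambda>x. f x - (\<Sum>J' | J' \<subset> J. H J' f x))"

section \<open>The recursion and its linearity\<close>

lemma finite_subset_D: "J \<subseteq> D \<Longrightarrow> finite J"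
  using finite_D finite_subset by blast

lemma finite_psubsets: "J \<subseteq> D \<Longrightarrow> finite {J'. J' \<subset> J}"
  by (rule finite_subset[of _ "Pow J"]) (auto simp: finite_subset_D)

lemma H_empty: "H {} = Exp"
  by (simp add: hop.simps)

lemma H_eq_residual: "J \<noteq> {} \<Longrightarrow> J \<subseteq> D \<Longrightarrow> H J g = residual J (\<L> J g)"
  unfolding residual_def by (subst hop.simps) (simp add: finite_subset_D)

lemma subset_D_induct [consumes 1, case_names psubset]:
  assumes "J \<subseteq> D" "\<And>J. J \<subseteq> D \<Longrightarrow> (\<And>K. K \<subset> J \<Longrightarrow> Q K) \<Longrightarrow> Q J"
  shows "Q J"
  using finite_subset_D[OF assms(1)] assms(1)
proof (induction J rule: finite_psubset_induct)
  case (psubset J)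
  show ?case
  proof (rule assms(2)[OF psubset.prems])
    fix K assume "K \<subset> J"
    then show "Q K" using psubset.IH psubset.prems by blast
  qed
qed

text \<open>Linearity is assumed at proper subsets only, so that the lemma can serve inside the
  induction for \<open>linear_op_H\<close>.\<close>

lemma linear_op_residual_if:
  assumes "\<And>K. K \<subset> J \<Longrightarrow> linear_op (VD D \<X>) (V K) (H K)" "J \<subseteq> J'"
  shows "linear_op (V J') (V J') (residual J)"
  unfolding residual_def
proof (intro linear_op_V_id_minus linear_op_V_sum)
  fix K assume "K \<in> {K. K \<subset> J}"
  then show "linear_op (V J') (V J') (H K)"
    using assms by (intro linear_op_subset[OF assms(1) V_subset_VD V_mono]) auto
qed

lemma linear_op_H: "J \<subseteq> D \<Longrightarrow> linear_op (VD D \<X>) (V J) (H J)"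
proof (induction J rule: subset_D_induct)
  case (psubset J)
  show ?case
  proof (cases "J = {}")
    case True
    then show ?thesis by (simp add: H_empty linear_op_Exp)
  next
    case False
    have "H J = (\<lambda>g. residual J (\<L> J g))"
      by (rule ext) (rule H_eq_residual[OF False psubset.hyps])
    moreover have "linear_op (VD D \<X>) (V J) (\<lambda>g. residual J (\<L> J g))"
      by (rule linear_op_comp[OF linear_op_residual_if[OF psubset.IH order_refl]
            L_linear[OF False psubset.hyps]])
    ultimately show ?thesis by (simp only:)
  qed
qed

lemma linear_op_residual: "J \<subseteq> J' \<Longrightarrow> J' \<subseteq> D \<Longrightarrow> linear_op (V J') (V J') (residual J)"
  by (rule linear_op_residual_if[OF linear_op_H]) auto

lemma H_zero: "J \<subseteq> D \<Longrightarrow> H J (\<lambda>x. 0) = (\<lambda>x. 0)"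
  using linear_op_zero[OF linear_op_H VD_nonempty] .

lemma H_in_VD: "J \<subseteq> D \<Longrightarrow> g \<in> VD D \<X> \<Longrightarrow> H J g \<in> VD D \<X>"
  by (rule subsetD[OF V_subset_VD linear_opD(1)[OF linear_op_H]])

lemma L_in_V: "J \<noteq> {} \<Longrightarrow> J \<subseteq> D \<Longrightarrow> g \<in> VD D \<X> \<Longrightarrow> \<L> J g \<in> V J"
  using linear_opD(1)[OF L_linear] .

section \<open>Annihilation and reconstruction, (P2) and (P3)\<close>

text \<open>By the decomposition it suffices that \<open>residual J\<close> kills \<open>V K\<close>
  for every proper subset \<open>K\<close>. Both properties are assumed below \<open>J\<close> only,
  as an induction provides them.\<close>

lemma residual_eq_0_if:
  assumes J: "J \<subseteq> D" and f: "f \<in> V J" and pz: "pz J f"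
    and P2: "\<And>K g. K \<subset> J \<Longrightarrow> g \<in> VD D \<X> \<Longrightarrow> pz K g \<Longrightarrow> H K g = (\<lambda>x. 0)"
    and P3: "\<And>K g. K \<subset> J \<Longrightarrow> g \<in> V K \<Longrightarrow> (\<lambda>x. \<Sum>J'\<in>Pow K. H J' g x) = g"
  shows "residual J f = (\<lambda>x. 0)"
proof -
  have van: "residual J u = (\<lambda>x. 0)" if K: "K \<subset> J" and u: "u \<in> V K" for K u
  proof
    fix x
    \<comment> \<open>Indices outside \<open>Pow K\<close> drop out by (P2), and by (P3) at
      \<open>K\<close> the remaining ones add up to \<open>u\<close>.\<close>
    have "H J' u = (\<lambda>x. 0)" if "J' \<subset> J" "\<not> J' \<subseteq> K" for J'
      using P2[OF that(1)] partial_zero_V[OF u _ that(2)] that J u V_subset_VD by blast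
    then have "(\<Sum>J' | J' \<subset> J. H J' u x) = (\<Sum>J'\<in>Pow K. H J' u x)"
      using K finite_psubsets[OF J] by (intro sum.mono_neutral_right) auto
    also have "\<dots> = u x" using fun_cong[OF P3[OF K u]] .
    finally show "residual J u x = 0" by (simp add: residual_def)
  qed
  obtain c u where u: "\<And>S. S \<in> Pow J - {{}} \<Longrightarrow> u S \<in> V (J - S)"
    and eq: "f = (\<lambda>x. \<Sum>S\<in>Pow J - {{}}. c S * u S x)"
    using partial_zero_decomposition[OF f J pz] by blast
  have "residual J (u S) = (\<lambda>x. 0)" if "S \<in> Pow J - {{}}" for S
    using van[OF _ u[OF that]] that by blast
  moreover have "linear_op (VD D \<X>) (VD D \<X>) (residual J)"
    using linear_op_residual[OF J order_refl] by (simp add: V_D)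
  then have "residual J f = (\<lambda>x. \<Sum>S\<in>Pow J - {{}}. c S * residual J (u S) x)"
    unfolding eq using u V_subset_VD by (intro linear_op_VD_sum) auto
  ultimately show ?thesis by simp
qed

lemma sum_Pow_H:
  assumes "J \<subseteq> D"
  shows "(\<Sum>J'\<in>Pow J. H J' g x) = H J g x + (\<Sum>J' | J' \<subset> J. H J' g x)"
proof -
  have "Pow J - {J} = {J'. J' \<subset> J}" by auto
  then show ?thesis using finite_subset_D[OF assms] by (subst sum.remove[of _ J]) auto
qed

text \<open>(P2) and (P3) are proved together, because the vanishing of \<open>residual J\<close> at
  functions with zero derivative uses both at all smaller sets.\<close>

lemma H_annihilates_and_reconstructs:
  assumes "J \<subseteq> D"
  shows "(\<forall>g\<in>VD D \<X>. pz J g \<longrightarrow> H J g = (\<lambda>x. 0)) \<and>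
    (\<forall>g\<in>V J. (\<lambda>x. \<Sum>J'\<in>Pow J. H J' g x) = g)"
  using assms
proof (induction J rule: subset_D_induct)
  case (psubset J)
  note J = psubset.hyps
  have res: "residual J f = (\<lambda>x. 0)" if "f \<in> V J" "pz J f" for f
  proof (rule residual_eq_0_if[OF J that])
    show "H K g = (\<lambda>x. 0)" if "K \<subset> J" "g \<in> VD D \<X>" "pz K g" for K g
      using conjunct1[OF psubset.IH[OF that(1)], rule_format, OF that(2,3)] .
    show "(\<lambda>x. \<Sum>J'\<in>Pow K. H J' g x) = g" if "K \<subset> J" "g \<in> V K" for K g
      using conjunct2[OF psubset.IH[OF that(1)], rule_format, OF that(2)] .
  qed
  show ?case
  proof (cases "J = {}")
    case True
    have "H {} g = (\<lambda>x. 0)" if "g \<in> VD D \<X>" "pz {} g" for g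
      using H_zero[OF empty_subsetI] partial_zero_empty[OF that] by simp
    moreover have "(\<lambda>x. \<Sum>J'\<in>Pow {}. H J' g x) = g" if "g \<in> V {}" for g
      using Exp_V_empty[OF that] by (simp add: H_empty)
    ultimately show ?thesis unfolding True by (intro conjI ballI impI)
  next
    case False
    have "H J g = (\<lambda>x. 0)" if "g \<in> VD D \<X>" "pz J g" for g
      using res[OF L_in_V[OF False J that(1)] L_partial_zero[OF False J that]]
      by (simp add: H_eq_residual[OF False J])
    moreover have "(\<lambda>x. \<Sum>J'\<in>Pow J. H J' g x) = g" if g: "g \<in> V J" for g
    proof -
      have Lg: "\<L> J g \<in> V J" using L_in_V[OF False J] g V_subset_VD by blast
      \<comment> \<open>By (P3)* the difference has zero derivative. Hence \<open>H J g\<close> is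
        \<open>g\<close> minus the lower components, which is (P3).\<close>
      have "residual J (\<lambda>x. \<L> J g x - g x) = (\<lambda>x. 0)"
        using res[OF V_diff[OF Lg g] L_minus_id[OF False J g]] .
      then have "residual J (\<L> J g) = residual J g"
        unfolding linear_op_diff[OF linear_op_residual[OF order_refl J] Lg g]
        by (simp add: fun_eq_iff)
      then have "H J g = residual J g" unfolding H_eq_residual[OF False J] .
      then show ?thesis
        unfolding sum_Pow_H[OF J] by (simp only: residual_def diff_add_cancel)
    qed
    ultimately show ?thesis by (intro conjI ballI impI)
  qed
qed

lemma H_partial_zero: "J \<subseteq> D \<Longrightarrow> g \<in> VD D \<X> \<Longrightarrow> pz J g \<Longrightarrow> H J g = (\<lambda>x. 0)"
  using conjunct1[OF H_annihilates_and_reconstructs] by simp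

lemma sum_H_eq: "J \<subseteq> D \<Longrightarrow> g \<in> V J \<Longrightarrow> (\<lambda>x. \<Sum>J'\<in>Pow J. H J' g x) = g"
  by (rule conjunct2[OF H_annihilates_and_reconstructs, rule_format])

lemma residual_eq_0:
  assumes "J \<subseteq> D" "f \<in> V J" "pz J f"
  shows "residual J f = (\<lambda>x. 0)"
proof (rule residual_eq_0_if[OF assms])
  fix K assume "K \<subset> J"
  then have K: "K \<subseteq> D" using assms(1) by blast
  show "H K g = (\<lambda>x. 0)" if "g \<in> VD D \<X>" "pz K g" for g
    by (rule H_partial_zero[OF K that])
  show "(\<lambda>x. \<Sum>J'\<in>Pow K. H J' g x) = g" if "g \<in> V K" for g
    by (rule sum_H_eq[OF K that])
qed

section \<open>Compositions of components, (P4) and (P5)\<close>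

text \<open>\<open>H J g\<close> depends on the variables in \<open>J\<close> only, so its
  derivative in the variables of \<open>K\<close> vanishes and (P2) applies.\<close>

lemma H_H_not_subset:
  assumes "J \<subseteq> D" "K \<subseteq> D" "\<not> K \<subseteq> J" "g \<in> VD D \<X>"
  shows "H K (H J g) = (\<lambda>x. 0)"
proof -
  have "H J g \<in> V J" by (rule linear_opD(1)[OF linear_op_H[OF assms(1)] assms(4) assms(4)])
  then show ?thesis
    using H_partial_zero[OF assms(2) H_in_VD[OF assms(1,4)]] partial_zero_V[OF _ assms(2,3)] by blast
qed

text \<open>In \<open>H K\<close> applied to \<open>residual J f\<close>, only the term of index
  \<open>K\<close> survives in the sum, and by idempotence at \<open>K\<close> it cancels
  \<open>H K f\<close>. Hence the two claims share one induction.\<close>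

lemma H_H_psubset_and_idem:
  assumes "J \<subseteq> D"
  shows "(\<forall>K g. K \<subset> J \<longrightarrow> g \<in> VD D \<X> \<longrightarrow> H K (H J g) = (\<lambda>x. 0)) \<and>
    (\<forall>g\<in>VD D \<X>. H J (H J g) = H J g)"
  using assms
proof (induction J rule: subset_D_induct)
  case (psubset J)
  note J = psubset.hyps
  have zero: "H K (H J g) = (\<lambda>x. 0)" if K: "K \<subset> J" and g: "g \<in> VD D \<X>" for K g
  proof -
    have ne: "J \<noteq> {}" and KD: "K \<subseteq> D" using K J by auto
    define f where "f = \<L> J g"
    have f: "f \<in> VD D \<X>" unfolding f_def using L_in_V[OF ne J g] V_subset_VD by blast
    have HK: "H J' f \<in> V D" if "J' \<in> {J'. J' \<subset> J}" for J'
      using that J H_in_VD[OF _ f] by (auto simp: V_D)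
    have S: "(\<lambda>x. \<Sum>J' | J' \<subset> J. H J' f x) \<in> VD D \<X>"
      unfolding V_D[symmetric] by (rule V_sum) (rule HK)
    have HH: "H K (H J' f) = (if J' = K then H K f else (\<lambda>x. 0))" if "J' \<subset> J" for J'
    proof -
      consider "J' = K" | "K \<subset> J'" | "\<not> K \<subseteq> J'" by blast
      then show ?thesis
        using psubset.IH[OF that] f H_H_not_subset[of J' K f] that J KD by cases auto
    qed
    have "H K (H J g) = (\<lambda>x. H K f x - H K (\<lambda>x. \<Sum>J' | J' \<subset> J. H J' f x) x)"
      unfolding H_eq_residual[OF ne J] residual_def f_def[symmetric]
      by (rule linear_op_diff[OF linear_op_H[OF KD] f S])
    also have "H K (\<lambda>x. \<Sum>J' | J' \<subset> J. H J' f x) = (\<lambda>x. \<Sum>J' | J' \<subset> J. H K (H J' f) x)"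
      using linear_op_VD_sum[OF linear_op_H[OF KD], of "{J'. J' \<subset> J}" "\<lambda>J'. H J' f" "\<lambda>_. 1"] HK
      by (simp add: V_D)
    also have "\<dots> = (\<lambda>x. \<Sum>J' | J' \<subset> J. if J' = K then H K f x else 0)"
      using HH by (intro ext sum.cong) auto
    also have "\<dots> = H K f"
      using K finite_psubsets[OF J] by (simp add: sum.delta)
    finally show ?thesis by simp
  qed
  moreover have "H J (H J g) = H J g" if g: "g \<in> VD D \<X>" for g
  proof
    fix x
    have "(\<Sum>J'\<in>Pow J. H J' (H J g) x) = H J g x"
      \<comment> \<open>(P3) is applied to \<open>H J g\<close> itself; by the first claim only its
        component of index \<open>J\<close> remains.\<close>
      using fun_cong[OF sum_H_eq[OF J linear_opD(1)[OF linear_op_H[OF J] g g]]] .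
    moreover have "(\<Sum>J' | J' \<subset> J. H J' (H J g) x) = 0"
      using zero[OF _ g] by (intro sum.neutral) auto
    ultimately show "H J (H J g) x = H J g x" by (simp add: sum_Pow_H[OF J])
  qed
  ultimately show ?case by blast
qed

lemma H_idem: "J \<subseteq> D \<Longrightarrow> g \<in> VD D \<X> \<Longrightarrow> H J (H J g) = H J g"
  using H_H_psubset_and_idem by blast

lemma H_H_neq:
  assumes "J \<subseteq> D" "K \<subseteq> D" "K \<noteq> J" "g \<in> VD D \<X>"
  shows "H K (H J g) = (\<lambda>x. 0)"
  using assms H_H_psubset_and_idem[OF assms(1)] H_H_not_subset by (cases "K \<subseteq> J") auto

section \<open>Sums of components under independence, (P6)\<close>

text \<open>The system of sums is triangular for inclusion: once the smaller components vanish, the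
  sum over \<open>Pow K\<close> reduces to \<open>H K q\<close>.\<close>

lemma H_eq_0_if_sums_eq_0:
  assumes "J \<subseteq> D" and sums: "\<And>K x. K \<subset> J \<Longrightarrow> (\<Sum>J'\<in>Pow K. H J' q x) = 0"
    and "K \<subset> J"
  shows "H K q = (\<lambda>x. 0)"
proof -
  have "K \<subseteq> D" using assms by auto
  then show ?thesis using assms(3)
  proof (induction K rule: subset_D_induct)
    case (psubset K)
    then have "(\<Sum>J' | J' \<subset> K. H J' q x) = 0" for x by (intro sum.neutral) auto
    then show ?case using sums[OF psubset.prems] by (simp add: sum_Pow_H[OF psubset.hyps] fun_eq_iff)
  qed
qed

text \<open>(P6)* turns \<open>H J g\<close> into \<open>residual J E\<close> with
  \<open>E = Marg J g\<close>. The lower components of \<open>g\<close> and \<open>E\<close> agree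
  by the tower property, so the total telescopes to \<open>E\<close>.\<close>

lemma sum_H_eq_Marg:
  assumes ind: "indep_vars (\<lambda>_. borel) X D"
    and L: "\<And>J g. J \<noteq> {} \<Longrightarrow> J \<subseteq> D \<Longrightarrow> g \<in> VD D \<X> \<Longrightarrow> pz J (\<lambda>x. \<L> J g x - Marg J g x)"
    and "J \<subseteq> D" "g \<in> VD D \<X>"
  shows "(\<lambda>x. \<Sum>J'\<in>Pow J. H J' g x) = Marg J g"
  using assms(3,4)
proof (induction J arbitrary: g rule: subset_D_induct)
  case (psubset J)
  note J = psubset.hyps and g = psubset.prems
  show ?case
  proof (cases "J = {}")
    case True
    then show ?thesis by (simp add: H_empty Marg_empty)
  next
    case False
    define E where "E = Marg J g"
    have E: "E \<in> V J" and EVD: "E \<in> VD D \<X>"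
      unfolding E_def using Marg_in_V[OF g J] V_subset_VD by auto
    have Lg: "\<L> J g \<in> V J" using L_in_V[OF False J g] .
    have "residual J (\<lambda>x. \<L> J g x - E x) = (\<lambda>x. 0)"
      using residual_eq_0[OF J V_diff[OF Lg E]] L[OF False J g] by (simp add: E_def)
    then have "residual J (\<L> J g) = residual J E"
      unfolding linear_op_diff[OF linear_op_residual[OF order_refl J] Lg E]
      by (simp add: fun_eq_iff)
    then have HJ: "H J g x = E x - (\<Sum>J' | J' \<subset> J. H J' E x)" for x
      unfolding H_eq_residual[OF False J] by (simp add: residual_def)
    have HK: "H K (\<lambda>x. g x - E x) x = H K g x - H K E x" if "K \<subset> J" for K x
      using linear_op_diff[OF linear_op_H g EVD, of K] that J by auto
    \<comment> \<open>The induction hypothesis is used at \<open>g\<close> and at \<open>E\<close>,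
      hence the generalisation over \<open>g\<close>.\<close>
    have "(\<Sum>J'\<in>Pow K. H J' (\<lambda>x. g x - E x) x) = 0" if K: "K \<subset> J" for K x
    proof -
      have "(\<Sum>J'\<in>Pow K. H J' (\<lambda>x. g x - E x) x) =
          (\<Sum>J'\<in>Pow K. H J' g x) - (\<Sum>J'\<in>Pow K. H J' E x)"
        using K by (subst sum_subtractf[symmetric]) (intro sum.cong refl HK, auto)
      also have "\<dots> = Marg K g x - Marg K E x"
        using fun_cong[OF psubset.IH[OF K g], of x] fun_cong[OF psubset.IH[OF K EVD], of x] by simp
      also have "\<dots> = 0"
        unfolding E_def using Marg_tower[OF ind J psubset_imp_subset[OF K] g] by simp
      finally show ?thesis .
    qed
    then have "H K (\<lambda>x. g x - E x) = (\<lambda>x. 0)" if "K \<subset> J" for K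
      using H_eq_0_if_sums_eq_0[OF J _ that] by blast
    then have "H K g x = H K E x" if "K \<subset> J" for K x
      using HK[OF that, of x] that by simp
    then show ?thesis
      by (simp add: sum_Pow_H[OF J] HJ E_def[symmetric])
  qed
qed

end

section \<open>Assembly of (P1) to (P6)\<close>

theorem mainTheorem1:
  fixes M :: "'w measure"
    and d :: nat
    and D :: "nat set"
    and X :: "nat \<Rightarrow> 'w \<Rightarrow> real"
    and \<X> :: "nat \<Rightarrow> real set"
    and \<L> :: "nat set \<Rightarrow> rfun \<Rightarrow> rfun"
    and H :: "nat set \<Rightarrow> rfun \<Rightarrow> rfun"
  assumes "prob_space M"
    and "d \<ge> 1"
    and D: "D = {1..d}"
    and "\<And>j. j \<in> D \<Longrightarrow> X j \<in> borel_measurable M"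
    and "\<And>j. j \<in> D \<Longrightarrow> compact (\<X> j) \<and> \<X> j \<noteq> {}"
    and "\<And>j. j \<in> D \<Longrightarrow> AE \<omega> in M. X j \<omega> \<in> \<X> j"
    and L_linear: "\<And>J. J \<noteq> {} \<Longrightarrow> J \<subseteq> D \<Longrightarrow> linear_op (VD D \<X>) (VJ D \<X> J) (\<L> J)"
    and P2s: "\<And>J g. J \<noteq> {} \<Longrightarrow> J \<subseteq> D \<Longrightarrow> g \<in> VD D \<X> \<Longrightarrow>
                partial_zero D \<X> J g \<Longrightarrow> partial_zero D \<X> J (\<L> J g)"
    and P3s: "\<And>J g. J \<noteq> {} \<Longrightarrow> J \<subseteq> D \<Longrightarrow> g \<in> VJ D \<X> J \<Longrightarrow>
                partial_zero D \<X> J (\<lambda>x. \<L> J g x - g x)"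
    and H: "H = hop M D X \<X> \<L>"
  shows
    "(\<forall>J\<subseteq>D. linear_op (VD D \<X>) (VJ D \<X> J) (H J)) \<and>
     \<comment> \<open>(P1)\<close>
     (\<forall>g\<in>VD D \<X>. H {} g = expect_op M D X \<X> g) \<and>
     (\<forall>J\<subseteq>D. J \<noteq> {} \<longrightarrow> (\<forall>g\<in>VD D \<X>. expect_op M D X \<X> (H J g) = (\<lambda>x. 0))) \<and>
     \<comment> \<open>(P2)\<close>
     (\<forall>J\<subseteq>D. \<forall>g\<in>VD D \<X>. partial_zero D \<X> J g \<longrightarrow> H J g = (\<lambda>x. 0)) \<and>
     \<comment> \<open>(P3)\<close>
     (\<forall>J\<subseteq>D. \<forall>g\<in>VJ D \<X> J. (\<lambda>x. \<Sum>J'\<in>Pow J. H J' g x) = g) \<and>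
     \<comment> \<open>(P4)\<close>
     (\<forall>J\<subseteq>D. \<forall>g\<in>VD D \<X>. H J (H J g) = H J g) \<and>
     \<comment> \<open>(P5)\<close>
     (\<forall>J\<subseteq>D. \<forall>J'\<subseteq>D. J' \<noteq> J \<longrightarrow> (\<forall>g\<in>VD D \<X>. H J' (H J g) = (\<lambda>x. 0))) \<and>
     \<comment> \<open>(P6)* implies (P6)\<close>
     ((\<forall>J\<subseteq>D. J \<noteq> {} \<longrightarrow>
         (prob_space.indep_vars M (\<lambda>_. borel) X D \<longrightarrow>
          (\<forall>g\<in>VD D \<X>.
             partial_zero D \<X> J (\<lambda>x. \<L> J g x - marginal_expect_op M D X \<X> J g x)))) \<longrightarrow>
      (prob_space.indep_vars M (\<lambda>_. borel) X D \<longrightarrow>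
       (\<forall>J\<subseteq>D. \<forall>g\<in>VD D \<X>.
          (\<lambda>x. \<Sum>J'\<in>Pow J. H J' g x) = marginal_expect_op M D X \<X> J g)))"
proof -
  interpret prob_space M by fact
  interpret hierarchical_decomposition M D X \<X> \<L>
  proof
    show "finite D" by (simp add: D)
    show "closed (\<X> j)" if "j \<in> D" for j using assms(5)[OF that] compact_imp_closed by blast
  qed (use assms(4-6) L_linear P2s P3s in auto)
  have sums: "(\<lambda>x. \<Sum>J'\<in>Pow J. H J' g x) = marginal_expect_op M D X \<X> J g"
    if "\<forall>J\<subseteq>D. J \<noteq> {} \<longrightarrow> (indep_vars (\<lambda>_. borel) X D \<longrightarrow> (\<forall>g\<in>VD D \<X>.
          partial_zero D \<X> J (\<lambda>x. \<L> J g x - marginal_expect_op M D X \<X> J g x)))"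
      "indep_vars (\<lambda>_. borel) X D" "J \<subseteq> D" "g \<in> VD D \<X>" for J g
    unfolding H by (rule sum_H_eq_Marg[OF that(2) _ that(3,4)]) (use that(1,2) in blast)
  \<comment> \<open>The expectation is the component of the empty set, so this is an instance of
    (P5).\<close>
  have Exp_H: "expect_op M D X \<X> (H J g) = (\<lambda>x. 0)"
    if "J \<subseteq> D" "J \<noteq> {}" "g \<in> VD D \<X>" for J g
    unfolding H using H_H_neq[OF that(1), of "{}" g] that by (simp add: H_empty)
  show ?thesis
  proof (intro conjI allI impI ballI, goal_cases)
    case (1 J)
    then show ?case unfolding H by (rule linear_op_H)
  next
    case (2 g)
    show ?case unfolding H H_empty ..
  next
    case (3 J g)
    then show ?case by (rule Exp_H)
  next
    case (4 J g)
    then show ?case unfolding H by (rule H_partial_zero)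
  next
    case (5 J g)
    then show ?case unfolding H by (rule sum_H_eq)
  next
    case (6 J g)
    then show ?case unfolding H by (rule H_idem)
  next
    case (7 J J' g)
    then show ?case unfolding H by (rule H_H_neq)
  next
    case (8 J g)
    then show ?case by (rule sums)
  qed
qed

end
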